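(* For all integers $n \ge 2$, we have $c_1(H(2,n)) = \left\lceil \frac{n+1}{2} \right\rceil$.
   Context: Graphs are finite and simple. For positive integers $d,n$, the Hamming graph $H(d,n)$ is the $d$-fold Cartesian product of $K_n$: its vertices are the $d$-tuples with entries in $\{1,\dots,n\}$, two being adjacent iff they differ in exactly one coordinate. $\ell$-visibility Cops and Robbers on a graph $G$ ($\ell$ a nonnegative integer): a team of one or more cops and a single robber occupy vertices of $G$ (several cops may share a vertex). First the cops choose initial positions, then the robber, knowing them, chooses his. Thereafter the game proceeds in rounds, each a cop turn (each cop stays or moves to an adjacent vertex) followed by a robber turn (the robber stays or moves to an adjacent vertex). The robber always knows the cops' positions. The robber's position is unknown to the cops unless some cop is at distance at most $\ell$ from him; in that case the cops see the robber and all cops know his position. The robber is captured if a cop ever occupies the same vertex as he does. $c_\ell(G)$ denotes the minimum number of cops having a strategy (depending only on the information available to the cops) that guarantees capture of the robber within a finite number of rounds, regardless of how the robber plays; equivalently, one may suppose the robber is omniscient, i.e. able to anticipate the cops' moves and respond optimally (so the cops cannot win merely by lucky guesses). *)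

theory Defs
  imports Complex_Main "Graph_Theory.Graph_Theory"
begin

text \<open>
  A finite simple graph is a \<^locale>\<open>pair_graph\<close>: a finite loopless symmetric digraph whose arcs
  are pairs of vertices.
\<close>

definition hamming_graph :: "nat \<Rightarrow> nat \<Rightarrow> nat list pair_pre_digraph" where
  "hamming_graph d n =
     (let V = {xs. length xs = d \<and> set xs \<subseteq> {1..n}}
      in \<lparr> pverts = V,
           parcs = {(xs, ys). xs \<in> V \<and> ys \<in> V \<and> card {i. i < d \<and> xs ! i \<noteq> ys ! i} = 1} \<rparr>)"

lemma pair_graph_hamming_graph: "pair_graph (hamming_graph d n)"
proof
  let ?G = "hamming_graph d n"
  have "pverts ?G = {xs. set xs \<subseteq> {1..n} \<and> length xs = d}"
    unfolding hamming_graph_def Let_def pair_pre_digraph.simps by blast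
  then show fin: "finite (pverts ?G)"
    by (simp only: finite_lists_length_eq finite_atLeastAtMost)
  have sub: "parcs ?G \<subseteq> pverts ?G \<times> pverts ?G"
    unfolding hamming_graph_def Let_def pair_pre_digraph.simps by blast
  then show "finite (parcs ?G)"
    using fin by (rule finite_subset[OF _ finite_cartesian_product]) fact
  show "fst e \<in> pverts ?G" "snd e \<in> pverts ?G" if "e \<in> parcs ?G" for e
    using sub that by (auto simp: mem_Times_iff)
  show "fst e \<noteq> snd e" if "e \<in> parcs ?G" for e
    using that by (cases e) (auto simp: hamming_graph_def Let_def)
  have "(ys, xs) \<in> parcs ?G" if "(xs, ys) \<in> parcs ?G" for xs ys
  proof -
    have "{i. i < d \<and> ys ! i \<noteq> xs ! i} = {i. i < d \<and> xs ! i \<noteq> ys ! i}" by (rule Collect_cong) metis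
    with that show ?thesis by (simp add: hamming_graph_def Let_def)
  qed
  then show "symmetric (with_proj ?G)"
    unfolding symmetric_def with_proj_simps by (rule symI)
qed

text \<open>Distance is the infimum of the lengths of walks, i.e. of their costs for unit arc costs.\<close>

definition graph_dist :: "'a pair_pre_digraph \<Rightarrow> 'a \<Rightarrow> 'a \<Rightarrow> ereal" where
  "graph_dist G u v = wf_digraph.\<mu> (with_proj G) (\<lambda>_. 1) u v"

definition stay_or_move :: "'a pair_pre_digraph \<Rightarrow> 'a \<Rightarrow> 'a \<Rightarrow> bool" where
  "stay_or_move G u v \<longleftrightarrow> u = v \<or> (u, v) \<in> parcs G"

text \<open>
  What the cops perceive of a robber at \<open>x\<close> when their positions are listed in \<open>C\<close>;
  \<^const>\<open>None\<close> means that no cop sees him.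
\<close>

definition sighting :: "'a pair_pre_digraph \<Rightarrow> nat \<Rightarrow> 'a list \<Rightarrow> 'a \<Rightarrow> 'a option" where
  "sighting G l C x = (if \<exists>c\<in>set C. graph_dist G c x \<le> ereal (real l) then Some x else None)"

text \<open>
  A cop strategy maps the chronological list of all sightings so far to the list of the next
  positions of the cops (entry \<open>i\<close> belongs to cop \<open>i\<close>); its value on the empty list is the initial
  placement. The cops' own earlier positions are determined by the strategy and the earlier
  sightings, so they need not be passed as arguments. A sighting is recorded after the initial
  placement of the robber and then after every single turn: a robber who is visible
  between a cop turn and the following robber turn is noticed as well.

  Since the strategy is deterministic, an omniscient robber is accounted for by considering all
  legal trajectories \<open>r\<close>, where \<open>r 0\<close> is the initial position and \<open>r (Suc t)\<close> is the position
  after the robber's turn of round \<open>Suc t\<close>.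
\<close>

type_synonym 'a cop_strategy = "'a option list \<Rightarrow> 'a list"

primrec sightings ::
    "'a pair_pre_digraph \<Rightarrow> nat \<Rightarrow> 'a cop_strategy \<Rightarrow> (nat \<Rightarrow> 'a) \<Rightarrow> nat \<Rightarrow> 'a option list" where
  "sightings G l \<sigma> r 0 = [sighting G l (\<sigma> []) (r 0)]"
| "sightings G l \<sigma> r (Suc t) =
     (let h = sightings G l \<sigma> r t; C = \<sigma> h
      in h @ [sighting G l C (r t), sighting G l C (r (Suc t))])"

primrec cop_positions ::
    "'a pair_pre_digraph \<Rightarrow> nat \<Rightarrow> 'a cop_strategy \<Rightarrow> (nat \<Rightarrow> 'a) \<Rightarrow> nat \<Rightarrow> 'a list" where
  "cop_positions G l \<sigma> r 0 = \<sigma> []"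
| "cop_positions G l \<sigma> r (Suc t) = \<sigma> (sightings G l \<sigma> r t)"

definition robber_trajectory :: "'a pair_pre_digraph \<Rightarrow> (nat \<Rightarrow> 'a) \<Rightarrow> bool" where
  "robber_trajectory G r \<longleftrightarrow> r 0 \<in> pverts G \<and> (\<forall>t. stay_or_move G (r t) (r (Suc t)))"

text \<open>
  Moves are required to be legal even after the capture, which is no restriction: the robber is
  visible when captured, so a strategy can let the cops stay put from then on.
\<close>

definition legal_cop_strategy ::
    "'a pair_pre_digraph \<Rightarrow> nat \<Rightarrow> nat \<Rightarrow> 'a cop_strategy \<Rightarrow> bool" where
  "legal_cop_strategy G l k \<sigma> \<longleftrightarrow>
     length (\<sigma> []) = k \<and> set (\<sigma> []) \<subseteq> pverts G \<and>
     (\<forall>r. robber_trajectory G r \<longrightarrow>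
        (\<forall>t. list_all2 (stay_or_move G) (cop_positions G l \<sigma> r t) (cop_positions G l \<sigma> r (Suc t))))"

text \<open>The robber may be caught after a robber turn (or the initial placement) or after a cop turn.\<close>

definition captured ::
    "'a pair_pre_digraph \<Rightarrow> nat \<Rightarrow> 'a cop_strategy \<Rightarrow> (nat \<Rightarrow> 'a) \<Rightarrow> bool" where
  "captured G l \<sigma> r \<longleftrightarrow>
     (\<exists>t. r t \<in> set (cop_positions G l \<sigma> r t) \<or> r t \<in> set (cop_positions G l \<sigma> r (Suc t)))"

definition cops_win :: "'a pair_pre_digraph \<Rightarrow> nat \<Rightarrow> nat \<Rightarrow> bool" where
  "cops_win G l k \<longleftrightarrow>
     (\<exists>\<sigma>. legal_cop_strategy G l k \<sigma> \<and> (\<forall>r. robber_trajectory G r \<longrightarrow> captured G l \<sigma> r))"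

definition cop_number :: "nat \<Rightarrow> 'a pair_pre_digraph \<Rightarrow> nat" where
  "cop_number l G = (LEAST k. k \<ge> 1 \<and> cops_win G l k)"

end

theory Submission
  imports Defs
begin

text \<open>
  The vertices of \<open>H(2,n)\<close> are the squares of an \<open>n\<close> by \<open>n\<close> board and the moves are those of a rook.
  A cop sees exactly the robbers in his own row or column, and these he captures on his next move.
  So after each of his turns the robber must stand on a \<^emph>\<open>hidden\<close> square, in a row and a column free
  of cops. Since \<open>\<lceil>(n + 1) / 2\<rceil> = n div 2 + 1\<close>, the claim is that \<open>k\<close> cops fail if \<open>2 * k \<le> n\<close> and
  that \<open>n div 2 + 1\<close> cops succeed.

  \<^emph>\<open>Few cops fail.\<close> A hidden robber is in danger only if the next cop turn puts cops both in his row
  and in his column; otherwise he can leave along the line that is still free. Let the cops stand at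
  \<open>D\<close>, with column \<open>b\<close> of the robber free. Their next positions \<open>E\<close> depend on the fact that he will be
  hidden, but not on the hidden square of column \<open>b\<close> that he picks, so he may pick it knowing \<open>E\<close>. A
  row that is used neither in \<open>D\<close> nor in \<open>E\<close> keeps him safe, and counting gives one whenever column
  \<open>b\<close> is used in \<open>E\<close>: a cop who enters column \<open>b\<close> does not change his row, so at most \<open>2 * k - 1\<close>
  rows are used altogether (\<open>free_line\<close>, \<open>robber_turn\<close>). Repeating this forever gives an escaping
  trajectory (\<open>prefix_choice\<close>, \<open>not_cops_win_rook\<close>).

  \<^emph>\<open>One more cop succeeds\<close> (\<open>cops_win_rook\<close>). Cops in distinct rows leave \<open>n - k < k\<close> rows free, so one turn
  suffices to enter all of these. The robber is then seen, and to hide he must leave his row, along a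
  column that the cops now know, to one of the \<open>n - k\<close> rows just left. The same cops return
  to these rows while a further cop enters his column. Both of his lines are then
  occupied, and he cannot hide any more.
\<close>

section \<open>Positions and sightings in an arbitrary game\<close>

text \<open>
  The empty walk exists only at vertices; an object outside the graph has infinite distance even to
  itself, whence the first conjunct.
\<close>

lemma (in pair_wf_digraph) graph_dist_le_1_iff:
  "graph_dist G u v \<le> 1 \<longleftrightarrow> u \<in> pverts G \<and> stay_or_move G u v"
proof
  assume "graph_dist G u v \<le> 1"
  then have "(INF p\<in>{p. awalk u p v}. ereal (awalk_cost (\<lambda>_. 1) p)) < 2"
    by (auto simp: graph_dist_def \<mu>_def intro: le_less_trans)
  then obtain p where p: "awalk u p v" "awalk_cost (\<lambda>_. 1) p < 2"
    by (auto simp: INF_less_iff)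
  have "length p < 2"
    using p(2) by (simp add: awalk_cost_def sum_list_triv)
  then consider "p = []" | e where "p = [e]"
    by (cases p; cases "tl p") auto
  then show "u \<in> pverts G \<and> stay_or_move G u v"
    using p(1) arc_fst_in_verts
    by cases (auto simp: stay_or_move_def awalk_Nil_iff awalk_Cons_iff)
next
  assume "u \<in> pverts G \<and> stay_or_move G u v"
  then have "awalk u [] v \<or> awalk u [(u, v)] v"
    by (auto simp: stay_or_move_def awalk_Nil_iff awalk_Cons_iff dest: in_arcsD2)
  then obtain p where p: "awalk u p v" "length p \<le> 1"
    by auto
  have "graph_dist G u v \<le> ereal (awalk_cost (\<lambda>_. 1) p)"
    unfolding graph_dist_def using p(1) by (rule min_cost_le_walk_cost)
  also have "\<dots> \<le> 1"
    using p(2) by (simp add: awalk_cost_def sum_list_triv)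
  finally show "graph_dist G u v \<le> 1" .
qed

lemma (in pair_wf_digraph) sighting_1:
  assumes "set C \<subseteq> pverts G"
  shows "sighting G 1 C x = (if \<exists>c\<in>set C. stay_or_move G c x then Some x else None)"
  using assms by (auto simp: sighting_def graph_dist_le_1_iff simp flip: one_ereal_def)

lemma last_sightings: "last (sightings G l \<sigma> r t) = sighting G l (cop_positions G l \<sigma> r t) (r t)"
  by (cases t) (simp_all add: Let_def)

lemma sightings_nonempty: "sightings G l \<sigma> r t \<noteq> []"
  by (cases t) (simp_all add: Let_def)

lemma sightings_cong:
  "(\<And>s. s \<le> t \<Longrightarrow> r s = r' s) \<Longrightarrow> sightings G l \<sigma> r t = sightings G l \<sigma> r' t"
  by (induction t) (simp_all add: Let_def)

lemma cop_positions_cong: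
  assumes "\<And>s. s < t \<Longrightarrow> r s = r' s"
  shows "cop_positions G l \<sigma> r t = cop_positions G l \<sigma> r' t"
  using assms by (cases t) (auto intro!: arg_cong[of _ _ \<sigma>] sightings_cong)

lemma (in pair_wf_digraph) stay_or_move_in_pverts:
  "stay_or_move G u v \<Longrightarrow> u \<in> pverts G \<Longrightarrow> v \<in> pverts G"
  by (auto simp: stay_or_move_def dest: in_arcsD2)

lemma (in pair_wf_digraph) trajectory_in_pverts:
  "robber_trajectory G r \<Longrightarrow> r t \<in> pverts G"
  by (induction t) (auto simp: robber_trajectory_def intro: stay_or_move_in_pverts)

lemma (in pair_wf_digraph) list_all2_stay_or_move_in_pverts:
  "list_all2 (stay_or_move G) C D \<Longrightarrow> set C \<subseteq> pverts G \<Longrightarrow> set D \<subseteq> pverts G"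
  by (induction rule: list_all2_induct) (auto intro: stay_or_move_in_pverts)

lemma (in pair_wf_digraph) cop_positions_in_pverts:
  assumes "legal_cop_strategy G l k \<sigma>" "robber_trajectory G r"
  shows "length (cop_positions G l \<sigma> r t) = k \<and> set (cop_positions G l \<sigma> r t) \<subseteq> pverts G"
proof (induction t)
  case 0
  then show ?case using assms by (simp add: legal_cop_strategy_def)
next
  case (Suc t)
  have "list_all2 (stay_or_move G) (cop_positions G l \<sigma> r t) (cop_positions G l \<sigma> r (Suc t))"
    using assms by (simp add: legal_cop_strategy_def)
  then show ?case
    using Suc list_all2_stay_or_move_in_pverts list_all2_lengthD by metis
qed

section \<open>Turning a plan into a legal strategy\<close>

text \<open>
  A plan only has to name sensible targets in the situations that matter: an order that its cop
  cannot carry out in one move is ignored. Each round adds two sightings to the history, so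
  dropping two of them leads back to the positions from which the cops move.
\<close>

function legalize :: "'a pair_pre_digraph \<Rightarrow> 'a cop_strategy \<Rightarrow> 'a cop_strategy" where
  "legalize G \<tau> h =
     (if h = [] then \<tau> []
      else map2 (\<lambda>p q. if stay_or_move G p q then q else p)
             (legalize G \<tau> (butlast (butlast h))) (\<tau> h))"
  by auto
termination by (relation "measure (\<lambda>(G, \<tau>, h). length h)") auto

declare legalize.simps[simp del]

lemma cop_positions_legalize_Suc:
  "cop_positions G l (legalize G \<tau>) r (Suc t) =
     map2 (\<lambda>p q. if stay_or_move G p q then q else p)
       (cop_positions G l (legalize G \<tau>) r t) (\<tau> (sightings G l (legalize G \<tau>) r t))"
proof -
  have "legalize G \<tau> (butlast (butlast (sightings G l (legalize G \<tau>) r t))) =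
    cop_positions G l (legalize G \<tau>) r t"
    by (cases t) (simp_all add: Let_def butlast_append)
  then show ?thesis
    by (simp add: legalize.simps[of G \<tau> "sightings G l (legalize G \<tau>) r t"] sightings_nonempty)
qed

lemma cop_positions_legalize_Suc_eq:
  assumes "list_all2 (stay_or_move G) (cop_positions G l (legalize G \<tau>) r t)
             (\<tau> (sightings G l (legalize G \<tau>) r t))"
  shows "cop_positions G l (legalize G \<tau>) r (Suc t) = \<tau> (sightings G l (legalize G \<tau>) r t)"
  unfolding cop_positions_legalize_Suc
  using assms by (induction rule: list_all2_induct) auto

lemma length_cop_positions_legalize:
  assumes "\<And>h. length (\<tau> h) = k"
  shows "length (cop_positions G l (legalize G \<tau>) r t) = k"
  by (induction t) (simp_all add: assms cop_positions_legalize_Suc legalize.simps[of G \<tau> "[]"]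
      del: cop_positions.simps(2))

lemma legal_legalize:
  assumes len: "\<And>h. length (\<tau> h) = k" and "set (\<tau> []) \<subseteq> pverts G"
  shows "legal_cop_strategy G l k (legalize G \<tau>)"
proof -
  have "list_all2 (stay_or_move G) (cop_positions G l (legalize G \<tau>) r t)
      (cop_positions G l (legalize G \<tau>) r (Suc t))" for r t
    unfolding cop_positions_legalize_Suc
    by (simp add: list_all2_conv_all_nth len length_cop_positions_legalize stay_or_move_def)
  then show ?thesis
    using assms by (simp add: legal_cop_strategy_def legalize.simps[of G \<tau> "[]"])
qed

text \<open>
  With visibility 1, a robber who is in sight after his own turn stands next to a cop. If the plan
  then orders every cop to his vertex, that cop can obey.
\<close>

lemma (in pair_wf_digraph) captured_if_visible:
  assumes len: "\<And>h. length (\<tau> h) = k" and "set (\<tau> []) \<subseteq> pverts G"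
    and pounce: "\<And>h x. h \<noteq> [] \<Longrightarrow> last h = Some x \<Longrightarrow> \<tau> h = replicate k x"
    and r: "robber_trajectory G r"
    and c: "c \<in> set (cop_positions G 1 (legalize G \<tau>) r t)" "stay_or_move G c (r t)"
  shows "captured G 1 (legalize G \<tau>) r"
proof -
  let ?P = "cop_positions G 1 (legalize G \<tau>) r"
  have "set (?P t) \<subseteq> pverts G"
    using cop_positions_in_pverts legal_legalize assms(1,2) r by blast
  then have "sighting G 1 (?P t) (r t) = Some (r t)"
    using c by (subst sighting_1) auto
  then have \<tau>: "\<tau> (sightings G 1 (legalize G \<tau>) r t) = replicate k (r t)"
    by (intro pounce) (simp_all add: sightings_nonempty last_sightings)
  obtain i where "i < length (?P t)" "?P t ! i = c"
    using c(1) by (auto simp: in_set_conv_nth)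
  moreover have "length (?P t) = k"
    using len by (rule length_cop_positions_legalize)
  ultimately have "i < length (?P (Suc t)) \<and> ?P (Suc t) ! i = r t"
    using c(2) by (simp add: cop_positions_legalize_Suc \<tau> del: cop_positions.simps One_nat_def)
  then have "r t \<in> set (?P (Suc t))"
    using nth_mem by metis
  then show ?thesis
    unfolding captured_def by blast
qed

section \<open>Extending a robber trajectory turn by turn\<close>

text \<open>
  The cops' behaviour up to a given round depends on the trajectory up to that round only. The
  robber can therefore be constructed one turn at a time, as long as each finite stage can be
  continued: the diagonal of the successive stages agrees with every stage as far as it matters.
\<close>

lemma prefix_choice:
  fixes P :: "nat \<Rightarrow> (nat \<Rightarrow> 'a) \<Rightarrow> bool"
  assumes prefix: "\<And>t r r'. P t r \<Longrightarrow> (\<And>s. s \<le> t \<Longrightarrow> r s = r' s) \<Longrightarrow> P t r'"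
    and base: "\<exists>r. P 0 r"
    and step: "\<And>t r. P t r \<Longrightarrow> \<exists>r'. (\<forall>s\<le>t. r' s = r s) \<and> P (Suc t) r'"
  shows "\<exists>r. \<forall>t. P t r"
proof -
  have "\<exists>f. \<forall>t. P t (f t) \<and> (\<forall>s\<le>t. f (Suc t) s = f t s)"
    by (rule dependent_nat_choice) (use base step in blast)+
  then obtain f where f: "\<And>t. P t (f t)" "\<And>t. \<forall>s\<le>t. f (Suc t) s = f t s"
    by blast
  have diag: "f t s = f s s" if "s \<le> t" for s t
    using that by (induction t rule: dec_induct) (simp_all add: f(2))
  have "P t (\<lambda>s. f s s)" for t
    by (rule prefix[OF f(1)]) (rule diag)
  then show ?thesis by blast
qed

section \<open>The rook's graph\<close>

lemma pverts_rook: "x \<in> pverts (hamming_graph 2 n) \<longleftrightarrow> (\<exists>a\<in>{1..n}. \<exists>b\<in>{1..n}. x = [a, b])"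
proof
  assume "x \<in> pverts (hamming_graph 2 n)"
  then have "length x = 2" "set x \<subseteq> {1..n}"
    by (auto simp: hamming_graph_def Let_def)
  then show "\<exists>a\<in>{1..n}. \<exists>b\<in>{1..n}. x = [a, b]"
    by (cases x; cases "tl x") auto
qed (auto simp: hamming_graph_def Let_def)

lemma stay_or_move_rook:
  assumes "x \<in> pverts (hamming_graph 2 n)" "y \<in> pverts (hamming_graph 2 n)"
  shows "stay_or_move (hamming_graph 2 n) x y \<longleftrightarrow> x ! 0 = y ! 0 \<or> x ! 1 = y ! 1"
proof -
  have "{i. i < 2 \<and> x ! i \<noteq> y ! i} =
      (if x ! 0 \<noteq> y ! 0 then {0} else {}) \<union> (if x ! 1 \<noteq> y ! 1 then {1} else {})"
    by (auto simp: less_2_cases_iff intro: gr0I)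
  then have "(x, y) \<in> parcs (hamming_graph 2 n) \<longleftrightarrow> (x ! 0 = y ! 0) \<noteq> (x ! 1 = y ! 1)"
    using assms by (auto simp: hamming_graph_def Let_def)
  moreover have "x = y \<longleftrightarrow> x ! 0 = y ! 0 \<and> x ! 1 = y ! 1"
    using assms by (auto simp: pverts_rook)
  ultimately show ?thesis
    by (auto simp: stay_or_move_def)
qed

interpretation rook: pair_graph "hamming_graph 2 n" for n
  by (rule pair_graph_hamming_graph)

section \<open>Evading half as many cops as there are rows\<close>

definition hidden :: "nat list list \<Rightarrow> nat list \<Rightarrow> bool" where
  "hidden C x \<longleftrightarrow> (\<forall>c\<in>set C. c ! 0 \<noteq> x ! 0) \<and> (\<forall>c\<in>set C. c ! 1 \<noteq> x ! 1)"

text \<open>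
  A robber is uncornered with respect to the positions \<open>C\<close> if one of his two lines is free, along
  which he can run away from a cop who has entered the other one.
\<close>

definition uncornered :: "nat list list \<Rightarrow> nat list \<Rightarrow> bool" where
  "uncornered C x \<longleftrightarrow> (\<forall>c\<in>set C. c ! 0 \<noteq> x ! 0) \<or> (\<forall>c\<in>set C. c ! 1 \<noteq> x ! 1)"

lemma hiddenD: "hidden C [a, b] \<Longrightarrow> [c, d] \<in> set C \<Longrightarrow> c \<noteq> a \<and> d \<noteq> b"
  by (force simp: hidden_def)

lemma sighting_hidden:
  assumes "set C \<subseteq> pverts (hamming_graph 2 n)" "x \<in> pverts (hamming_graph 2 n)"
  shows "sighting (hamming_graph 2 n) 1 C x = (if hidden C x then None else Some x)"
  using assms by (subst rook.sighting_1) (auto simp: hidden_def stay_or_move_rook subset_iff)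

text \<open>
  A counting argument, read with \<open>p\<close> and \<open>q\<close> as row and column of a cop who moves from \<open>D\<close> to
  \<open>E\<close>. If no cop enters column \<open>b\<close>, a row that is free before the move suffices. A cop who does
  enter it changes his column, hence keeps his row; so the rows used before or after the move
  number at most \<open>2 * length D - 1\<close>.
\<close>

lemma free_line:
  fixes p q :: "'a \<Rightarrow> 'b"
  assumes move: "list_all2 (\<lambda>c d. p c = p d \<or> q c = q d) D E"
    and N: "finite N" "N \<noteq> {}" "2 * length D \<le> card N"
    and b: "b \<notin> q ` set D"
  obtains a where "a \<in> N" "a \<notin> p ` set D" "a \<notin> p ` set E \<or> b \<notin> q ` set E"
proof (cases "b \<in> q ` set E")
  case False
  have "card (p ` set D) \<le> length D"
    by (metis card_image_le card_length finite_set le_trans)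
  moreover have "card N > 0"
    using N by (simp add: card_gt_0_iff)
  ultimately have "\<not> N \<subseteq> p ` set D"
    using N card_mono[of "p ` set D" N] by fastforce
  with False show ?thesis using that by blast
next
  case True
  then obtain i where i: "i < length E" "q (E ! i) = b"
    by (auto simp: in_set_conv_nth)
  have len: "length D = length E"
    using move by (rule list_all2_lengthD)
  have "q (D ! i) \<noteq> b"
    using b i len by (metis image_eqI nth_mem)
  then have row: "p (E ! i) = p (D ! i)"
    using list_all2_nthD2[OF move i(1)] i(2) by auto
  let ?J = "{..<length E} - {i}"
  have "p ` set E \<subseteq> p ` set D \<union> (\<lambda>j. p (E ! j)) ` ?J"
  proof
    fix a assume "a \<in> p ` set E"
    then obtain j where "j < length E" "a = p (E ! j)"
      by (auto simp: in_set_conv_nth)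
    then show "a \<in> p ` set D \<union> (\<lambda>j. p (E ! j)) ` ?J"
      using row len by (cases "j = i") auto
  qed
  then have "card (p ` set D \<union> p ` set E) \<le> card (p ` set D \<union> (\<lambda>j. p (E ! j)) ` ?J)"
    by (intro card_mono) auto
  also have "\<dots> \<le> card (p ` set D) + card ((\<lambda>j. p (E ! j)) ` ?J)"
    by (rule card_Un_le)
  also have "\<dots> \<le> length D + (length D - 1)"
  proof (rule add_mono)
    show "card (p ` set D) \<le> length D"
      by (metis card_image_le card_length finite_set le_trans)
    have "card ((\<lambda>j. p (E ! j)) ` ?J) \<le> card ?J"
      by (rule card_image_le) simp
    also have "card ?J = length D - 1"
      using i len by simp
    finally show "card ((\<lambda>j. p (E ! j)) ` ?J) \<le> length D - 1" .
  qed
  also have "\<dots> < card N"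
    using N i len by simp
  finally have "\<not> N \<subseteq> p ` set D \<union> p ` set E"
    using card_mono[of "p ` set D \<union> p ` set E" N] by fastforce
  then show ?thesis using that by blast
qed

text \<open>
  If no cop shares, say, his column, the robber runs along it to a row that \<open>free_line\<close>
  provides.
\<close>

lemma robber_turn:
  assumes n: "0 < n" "2 * length D \<le> n"
    and D: "set D \<subseteq> pverts (hamming_graph 2 n)"
    and move: "list_all2 (stay_or_move (hamming_graph 2 n)) D E"
    and x: "x \<in> pverts (hamming_graph 2 n)" "uncornered D x"
  obtains y where "y \<in> pverts (hamming_graph 2 n)" "stay_or_move (hamming_graph 2 n) x y"
    "hidden D y" "uncornered E y"
proof -
  have E: "set E \<subseteq> pverts (hamming_graph 2 n)"
    using rook.list_all2_stay_or_move_in_pverts move D by blast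
  have move01: "list_all2 (\<lambda>c d. c ! 0 = d ! 0 \<or> c ! 1 = d ! 1) D E"
    using move by (rule list.rel_mono_strong)
      (use D E in \<open>auto simp: stay_or_move_rook subset_iff\<close>)
  then have move10: "list_all2 (\<lambda>c d. c ! 1 = d ! 1 \<or> c ! 0 = d ! 0) D E"
    by (rule list_all2_mono) auto
  have N: "finite {1..n}" "{1..n} \<noteq> {}" "2 * length D \<le> card {1..n}"
    using n by auto
  obtain a b where ab: "x = [a, b]" "a \<in> {1..n}" "b \<in> {1..n}"
    using x(1) by (auto simp: pverts_rook)
  consider "b \<notin> (\<lambda>c. c ! 1) ` set D" | "a \<notin> (\<lambda>c. c ! 0) ` set D"
    using x(2) ab(1) by (fastforce simp: uncornered_def)
  then show ?thesis
  proof cases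
    case 1
    obtain a' where a': "a' \<in> {1..n}" "a' \<notin> (\<lambda>c. c ! 0) ` set D"
      "a' \<notin> (\<lambda>c. c ! 0) ` set E \<or> b \<notin> (\<lambda>c. c ! 1) ` set E"
      by (rule free_line[OF move01 N 1])
    have y: "[a', b] \<in> pverts (hamming_graph 2 n)"
      using a' ab by (simp add: pverts_rook)
    show ?thesis
      by (rule that[OF y])
        (use x(1) y ab 1 a' in \<open>auto simp: stay_or_move_rook hidden_def uncornered_def\<close>)
  next
    case 2
    obtain b' where b': "b' \<in> {1..n}" "b' \<notin> (\<lambda>c. c ! 1) ` set D"
      "b' \<notin> (\<lambda>c. c ! 1) ` set E \<or> a \<notin> (\<lambda>c. c ! 0) ` set E"
      by (rule free_line[OF move10 N 2])
    have y: "[a, b'] \<in> pverts (hamming_graph 2 n)"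
      using b' ab by (simp add: pverts_rook)
    show ?thesis
      by (rule that[OF y])
        (use x(1) y ab 2 b' in \<open>auto simp: stay_or_move_rook hidden_def uncornered_def\<close>)
  qed
qed

text \<open>
  The invariant \<open>P\<close> says that the robber is hidden after his turn and will still be uncornered after the
  cops' next turn. To preserve it he applies \<open>robber_turn\<close> twice. The first application, to a
  cop team that stays put, shows that a hidden square is within reach; this is what makes the cops'
  reply \<open>E\<close> to not seeing him the outcome of a genuine game, hence a legal move. All reachable
  hidden squares provoke the same reply, so the second application can choose among them with
  regard to \<open>E\<close>.
\<close>

lemma not_cops_win_rook:
  assumes n: "0 < n" "2 * k \<le> n"
  shows "\<not> cops_win (hamming_graph 2 n) 1 k"
proof
  let ?G = "hamming_graph 2 n"
  assume "cops_win ?G 1 k"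
  then obtain \<sigma> where legal: "legal_cop_strategy ?G 1 k \<sigma>"
    and win: "\<And>r. robber_trajectory ?G r \<Longrightarrow> captured ?G 1 \<sigma> r"
    unfolding cops_win_def by blast
  let ?C = "cop_positions ?G 1 \<sigma>"
  have legalD: "list_all2 (stay_or_move ?G) (?C r t) (?C r (Suc t))"
    if "robber_trajectory ?G r" for r t
    using legal that by (simp add: legal_cop_strategy_def)
  define P where "P t r \<longleftrightarrow> r 0 \<in> pverts ?G \<and> (\<forall>s<t. stay_or_move ?G (r s) (r (Suc s))) \<and>
    hidden (?C r t) (r t) \<and> uncornered (?C r (Suc t)) (r t)" for t r
  have "\<exists>r. \<forall>t. P t r"
  proof (rule prefix_choice)
    fix t r r'
    assume P: "P t r" and eq: "\<And>s. s \<le> t \<Longrightarrow> r s = r' s"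
    have "?C r t = ?C r' t" "?C r (Suc t) = ?C r' (Suc t)"
      using eq by (auto intro!: cop_positions_cong simp del: cop_positions.simps)
    then show "P t r'"
      using P eq by (auto simp: P_def simp del: cop_positions.simps)
  next
    have \<sigma>0: "set (\<sigma> []) \<subseteq> pverts ?G" "length (\<sigma> []) = k"
      using legal by (auto simp: legal_cop_strategy_def)
    have "card ((\<lambda>c. c ! 1) ` set (\<sigma> [])) \<le> k"
      using \<sigma>0 by (metis card_image_le card_length finite_set le_trans)
    then have "\<not> {1..n} \<subseteq> (\<lambda>c. c ! 1) ` set (\<sigma> [])"
      using n card_mono[of "(\<lambda>c. c ! 1) ` set (\<sigma> [])" "{1..n}"] by fastforce
    then obtain b where b: "b \<in> {1..n}" "b \<notin> (\<lambda>c. c ! 1) ` set (\<sigma> [])"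
      by blast
    have x: "[1, b] \<in> pverts ?G" "uncornered (\<sigma> []) [1, b]"
      using b n by (auto simp: pverts_rook uncornered_def)
    have refl: "list_all2 (stay_or_move ?G) (\<sigma> []) (\<sigma> [])"
      by (simp add: list_all2_same stay_or_move_def)
    have C: "?C (\<lambda>_. y) (Suc 0) = \<sigma> [None]" if "y \<in> pverts ?G" "hidden (\<sigma> []) y" for y
      using that \<sigma>0 by (simp add: sighting_hidden del: One_nat_def)
    \<comment> \<open>Any hidden square serves to see that the reply to \<open>[None]\<close> is a legal move.\<close>
    obtain y0 where y0: "y0 \<in> pverts ?G" "hidden (\<sigma> []) y0"
      using robber_turn[OF n(1) _ \<sigma>0(1) refl x] \<sigma>0(2) n(2) by auto
    have "list_all2 (stay_or_move ?G) (\<sigma> []) (\<sigma> [None])"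
      using legalD[of "\<lambda>_. y0" 0] y0 C[OF y0]
      by (simp add: robber_trajectory_def stay_or_move_def)
    then obtain y where y: "y \<in> pverts ?G" "hidden (\<sigma> []) y" "uncornered (\<sigma> [None]) y"
      using robber_turn[OF n(1) _ \<sigma>0(1) _ x] \<sigma>0(2) n(2) by auto
    then show "\<exists>r. P 0 r"
      using C[OF y(1,2)] by (intro exI[of _ "\<lambda>_. y"]) (simp add: P_def)
  next
    fix t r
    assume P: "P t r"
    define ext where "ext y s = (if s \<le> t then r s else y)" for y s
    have ext_traj: "robber_trajectory ?G (ext y)" if "stay_or_move ?G (r t) y" for y
    proof -
      have "stay_or_move ?G (ext y s) (ext y (Suc s))" for s
        using P that by (cases s t rule: linorder_cases) (auto simp: P_def ext_def stay_or_move_def)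
      then show ?thesis
        using P by (simp add: robber_trajectory_def P_def ext_def)
    qed
    define D where "D = ?C r (Suc t)"
    define E where "E = \<sigma> (sightings ?G 1 \<sigma> r t @ [sighting ?G 1 D (r t), None])"
    have traj: "robber_trajectory ?G (ext (r t))"
      by (rule ext_traj) (simp add: stay_or_move_def)
    have D_ext: "?C (ext y) (Suc t) = D" for y
      unfolding D_def by (rule cop_positions_cong) (simp add: ext_def)
    have D: "set D \<subseteq> pverts ?G" "length D = k"
      using rook.cop_positions_in_pverts[OF legal traj, of "Suc t"] D_ext by auto
    have x: "r t \<in> pverts ?G" "uncornered D (r t)"
      using rook.trajectory_in_pverts[OF traj, of t] P by (auto simp: ext_def P_def D_def)
    have C: "?C (ext y) (Suc (Suc t)) = E" if "y \<in> pverts ?G" "hidden D y" for y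
    proof -
      have "sightings ?G 1 \<sigma> (ext y) t = sightings ?G 1 \<sigma> r t"
        by (rule sightings_cong) (simp add: ext_def)
      moreover have "sighting ?G 1 D y = None"
        using D that by (simp add: sighting_hidden del: One_nat_def)
      ultimately show ?thesis
        by (simp add: E_def D_def ext_def Let_def del: One_nat_def)
    qed
    have refl: "list_all2 (stay_or_move ?G) D D"
      by (simp add: list_all2_same stay_or_move_def)
    obtain y0 where y0: "y0 \<in> pverts ?G" "stay_or_move ?G (r t) y0" "hidden D y0"
      using robber_turn[OF n(1) _ D(1) refl x] D(2) n(2) by metis
    have "list_all2 (stay_or_move ?G) D E"
      using legalD[OF ext_traj[OF y0(2)], of "Suc t"] C[OF y0(1,3)] D_ext by metis
    then obtain y where y: "y \<in> pverts ?G" "stay_or_move ?G (r t) y" "hidden D y" "uncornered E y"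
      using robber_turn[OF n(1) _ D(1) _ x] D(2) n(2) by metis
    have "ext y (Suc t) = y"
      by (simp add: ext_def)
    then have "P (Suc t) (ext y)"
      using ext_traj[OF y(2)] C[OF y(1,3)] D_ext[of y] y
      by (simp add: P_def robber_trajectory_def del: cop_positions.simps)
    then show "\<exists>r'. (\<forall>s\<le>t. r' s = r s) \<and> P (Suc t) r'"
      by (intro exI[of _ "ext y"]) (simp add: ext_def)
  qed
  then obtain r where r: "\<And>t. P t r"
    by blast
  have "robber_trajectory ?G r"
    using r by (auto simp: P_def robber_trajectory_def)
  moreover have "r t \<notin> set (?C r t)" "r t \<notin> set (?C r (Suc t))" for t
    using r[of t] by (auto simp: P_def hidden_def uncornered_def simp del: cop_positions.simps)
  ultimately show False
    using win unfolding captured_def by blast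
qed

section \<open>Cornering the robber with one more cop\<close>

text \<open>
  Histories of length 1 and 3 are those before the first and the second cop turn. Initially cop \<open>i\<close>
  stands in row \<open>i\<close>, and everybody stays in column 1 except that cop \<open>k\<close> finally enters the robber's
  column. That column is read off from \<open>h ! 1\<close>, the sighting between the first cop turn and the
  robber's answer.
\<close>

definition rook_plan :: "nat \<Rightarrow> nat list cop_strategy" where
  "rook_plan n h =
     (let k = n div 2 + 1 in
      if h \<noteq> [] \<and> last h \<noteq> None then replicate k (the (last h))
      else if length h = 1 then map (\<lambda>i. [if i \<le> n - k then k + i else i, 1]) [1..<k + 1]
      else if length h = 3 then map (\<lambda>i. [i, if i = k then the (h ! 1) ! 1 else 1]) [1..<k + 1]
      else map (\<lambda>i. [i, 1]) [1..<k + 1])"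

text \<open>
  A robber who is never captured is hidden after each of his turns, because otherwise the cops
  pounce. It remains to follow the plan until he has nowhere to hide.
\<close>

lemma cops_win_rook:
  assumes "n \<ge> 2"
  shows "cops_win (hamming_graph 2 n) 1 (n div 2 + 1)"
proof -
  let ?G = "hamming_graph 2 n"
  define k where "k = n div 2 + 1"
  define m where "m = n - k"
  have k: "1 \<le> k" "k \<le> n" "m < k" "k + m = n"
    using assms by (auto simp: k_def m_def)
  define \<tau> where "\<tau> = rook_plan n"
  let ?C = "cop_positions ?G 1 (legalize ?G \<tau>)"
  have len: "length (\<tau> h) = k" for h
    by (simp add: \<tau>_def rook_plan_def k_def Let_def)
  have \<tau>0: "\<tau> [] = map (\<lambda>i. [i, 1]) [1..<k + 1]"
    and \<tau>1: "\<tau> [None] = map (\<lambda>i. [if i \<le> m then k + i else i, 1]) [1..<k + 1]"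
    and \<tau>3: "\<tau> [s, s', None] = map (\<lambda>i. [i, if i = k then the s' ! 1 else 1]) [1..<k + 1]" for s s'
    by (simp_all add: \<tau>_def rook_plan_def k_def m_def Let_def del: upt_Suc)
  have \<tau>0_vert: "set (\<tau> []) \<subseteq> pverts ?G"
    using k by (auto simp: \<tau>0 pverts_rook simp del: upt_Suc)
  have pounce: "\<tau> h = replicate k x" if "h \<noteq> []" "last h = Some x" for h x
    using that by (simp add: \<tau>_def rook_plan_def k_def Let_def)
  note legal = legal_legalize[of \<tau>, OF len \<tau>0_vert]
  have "captured ?G 1 (legalize ?G \<tau>) r" if r: "robber_trajectory ?G r" for r
  proof (rule ccontr)
    assume free: "\<not> captured ?G 1 (legalize ?G \<tau>) r"
    note rv = rook.trajectory_in_pverts[OF r]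
    note Cv = rook.cop_positions_in_pverts[OF legal r, where l = 1, THEN conjunct2]
    have move: "stay_or_move ?G (r t) (r (Suc t))" for t
      using r by (simp add: robber_trajectory_def)
    have hid: "hidden (?C r t) (r t)" for t
    proof -
      have "\<not> stay_or_move ?G c (r t)" if "c \<in> set (?C r t)" for c
        using rook.captured_if_visible[of \<tau>, OF len \<tau>0_vert pounce r that] free by blast
      then show ?thesis
        using rv[of t] Cv[of t]
        by (auto simp: hidden_def stay_or_move_rook subset_iff simp del: cop_positions.simps)
    qed
    then have none: "sighting ?G 1 (?C r t) (r t) = None" for t
      using sighting_hidden[OF Cv rv] by simp

    \<comment> \<open>The robber starts in one of the rows \<open>k + 1, \<dots>, n\<close>, which the first \<open>m\<close> cops enter.\<close>
    have C0: "?C r 0 = map (\<lambda>i. [i, 1]) [1..<k + 1]"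
      by (simp add: legalize.simps[of _ _ "[]"] \<tau>0 del: upt_Suc)
    have h0: "sightings ?G 1 (legalize ?G \<tau>) r 0 = [None]"
      using none[of 0] by simp
    have C1: "?C r (Suc 0) = map (\<lambda>i. [if i \<le> m then k + i else i, 1]) [1..<k + 1]"
      unfolding h0[symmetric] \<tau>1[symmetric]
    proof (rule cop_positions_legalize_Suc_eq)
      show "list_all2 (stay_or_move ?G) (?C r 0) (\<tau> (sightings ?G 1 (legalize ?G \<tau>) r 0))"
        unfolding h0 \<tau>1 C0 using k
        by (auto simp: list_all2_map1 list_all2_map2 list_all2_same stay_or_move_rook pverts_rook
            simp del: upt_Suc)
    qed
    obtain a b where ab: "r 0 = [a, b]" "a \<in> {1..n}" "b \<in> {1..n}"
      using rv[of 0] by (auto simp: pverts_rook)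
    have "a \<notin> {1..k}"
      using hid[of 0] unfolding C0 by (auto simp: hidden_def ab(1) simp del: upt_Suc)
    then have a: "a \<in> {k + 1..k + m}"
      using ab k by auto
    have s1: "sighting ?G 1 (?C r (Suc 0)) (r 0) = Some [a, b]"
    proof -
      have "[a, 1] \<in> set (?C r (Suc 0))"
        unfolding C1 using a k by (auto simp del: upt_Suc intro!: image_eqI[of _ _ "a - k"])
      then have "\<not> hidden (?C r (Suc 0)) (r 0)"
        using hiddenD ab(1) by metis
      then show ?thesis
        using sighting_hidden[OF Cv rv, of "Suc 0" 0] ab(1) by (simp del: cop_positions.simps)
    qed
    have h1: "sightings ?G 1 (legalize ?G \<tau>) r (Suc 0) = [None, Some [a, b], None]"
      using s1 none[of "Suc 0"] h0 by (simp add: Let_def del: One_nat_def)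
    \<comment> \<open>He fled to one of the first \<open>m\<close> rows, to which the first \<open>m\<close> cops return; since \<open>m < k\<close>, cop
      \<open>k\<close> is spare and takes the column.\<close>
    have C2: "?C r (Suc (Suc 0)) = map (\<lambda>i. [i, if i = k then b else 1]) [1..<k + 1]"
    proof -
      have "list_all2 (stay_or_move ?G) (?C r (Suc 0))
          (\<tau> (sightings ?G 1 (legalize ?G \<tau>) r (Suc 0)))"
        unfolding h1 \<tau>3 C1 using k ab
        by (auto simp: list_all2_map1 list_all2_map2 list_all2_same stay_or_move_rook pverts_rook
            simp del: upt_Suc)
      then have "?C r (Suc (Suc 0)) = \<tau> [None, Some [a, b], None]"
        using cop_positions_legalize_Suc_eq h1 by metis
      then show ?thesis
        using \<tau>3[of None "Some [a, b]"] by simp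
    qed
    obtain a1 b1 where ab1: "r (Suc 0) = [a1, b1]" "a1 \<in> {1..n}" "b1 \<in> {1..n}"
      using rv[of "Suc 0"] by (auto simp: pverts_rook)
    have a1: "a1 \<le> m"
    proof (rule ccontr)
      assume "\<not> a1 \<le> m"
      then have "[a1, 1] \<in> set (?C r (Suc 0))"
        unfolding C1 using ab1 k
        by (auto simp del: upt_Suc intro!: image_eqI[of _ _ "if a1 \<le> k then a1 else a1 - k"])
      then show False
        using hid[of "Suc 0"] hiddenD ab1(1) by metis
    qed
    then have b1: "b1 = b"
      using move[of 0] rv[of 0] rv[of "Suc 0"] a k by (auto simp: ab ab1 stay_or_move_rook)
    obtain a2 b2 where ab2: "r (Suc (Suc 0)) = [a2, b2]"
      using rv[of "Suc (Suc 0)"] by (auto simp: pverts_rook)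
    have "a2 = a1 \<or> b2 = b"
      using move[of "Suc 0"] rv[of "Suc 0"] rv[of "Suc (Suc 0)"]
      by (auto simp: ab1 ab2 b1 stay_or_move_rook)
    moreover have "[a1, 1] \<in> set (?C r (Suc (Suc 0)))" "[k, b] \<in> set (?C r (Suc (Suc 0)))"
      unfolding C2 using a1 ab1(2) k by (auto simp del: upt_Suc)
    ultimately show False
      using hid[of "Suc (Suc 0)"] hiddenD ab2 by metis
  qed
  then show ?thesis
    using legal unfolding cops_win_def k_def by blast
qed

theorem theorem3p4:
  fixes n :: nat
  assumes "n \<ge> 2"
  shows "int (cop_number 1 (hamming_graph 2 n)) = \<lceil>(real n + 1) / 2\<rceil>"
proof -
  have "cop_number 1 (hamming_graph 2 n) = n div 2 + 1"
    unfolding cop_number_def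
  proof (rule Least_equality)
    show "1 \<le> n div 2 + 1 \<and> cops_win (hamming_graph 2 n) 1 (n div 2 + 1)"
      using cops_win_rook[OF assms] by simp
    show "n div 2 + 1 \<le> k" if "1 \<le> k \<and> cops_win (hamming_graph 2 n) 1 k" for k
      using that not_cops_win_rook[of n k] assms by linarith
  qed
  moreover have "\<lceil>(real n + 1) / 2\<rceil> = int (n div 2 + 1)"
  proof -
    have "2 * (n div 2) \<le> n" "n \<le> 2 * (n div 2) + 1"
      by linarith+
    then have "2 * real (n div 2) \<le> real n" "real n \<le> 2 * real (n div 2) + 1"
      by linarith+
    then show ?thesis
      by (intro ceiling_unique) simp_all
  qed
  ultimately show ?thesis by simp
qed

end
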